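(* Let $p$ be a prime, $r\in\{1,\dots,p-1\}$, and let $A\subset\mathbb{F}_p$ be an $r$-arithmetic set. If $B\subset\mathbb{F}_p^n$ is a multiset which is the (multiset) union of at least $p/r$ linear bases of $\mathbb{F}_p^n$, then every $w\in\mathbb{F}_p^n$ can be written as $w=\sum_{v\in B}\alpha_vv$ with $\alpha_v\in A$ for every $v\in B$.
   Context: For integers $a<b$, $[a,b]=\{a,\dots,b\}$ and $[r]=\{1,\dots,r\}$. A set $A\subset\mathbb{F}_p$ is $r$-arithmetic if (1) for every $a\in A$ there exists $b\in\mathbb{F}_p^*$ with $a+ib\in A$ for all $i\in[-r,r]$, and (2) for every $a\in\mathbb{F}_p\setminus A$ there exists $b\in\mathbb{F}_p^*$ with $a+ib\in A$ for all $i\in[r]$. Sums over the multiset $B$ are with multiplicity (each copy gets its own coefficient). *)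

theory Defs
  imports "HOL-Analysis.Analysis" "HOL-Library.Multiset" "Berlekamp_Zassenhaus.Finite_Field"
begin

text \<open>
  The field with \<open>p\<close> elements is \<open>'p mod_ring\<close> with \<open>'p :: prime_card\<close> and \<open>p = CARD('p)\<close>;
  its \<open>n\<close>-dimensional coordinate space is \<open>'p mod_ring ^ 'n\<close> with \<open>n = CARD('n)\<close>.
\<close>

definition r_arithmetic :: "nat \<Rightarrow> 'p::prime_card mod_ring set \<Rightarrow> bool" where
  "r_arithmetic r A \<longleftrightarrow>
     (\<forall>a\<in>A. \<exists>b. b \<noteq> 0 \<and> (\<forall>i\<in>{- int r..int r}. a + of_int i * b \<in> A)) \<and>
     (\<forall>a\<in>- A. \<exists>b. b \<noteq> 0 \<and> (\<forall>i\<in>{1..int r}. a + of_int i * b \<in> A))"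

definition is_linear_basis :: "('a::field ^ 'n) set \<Rightarrow> bool" where
  "is_linear_basis S \<longleftrightarrow> vec.independent S \<and> vec.span S = UNIV"

text \<open>
  The multiset union is additive: multiplicities add up, and the same basis may be used repeatedly.
  Linear bases of the coordinate space are finite, so \<open>mset_set\<close> loses nothing.
\<close>

definition is_union_of_bases :: "nat \<Rightarrow> ('a::field ^ 'n) multiset \<Rightarrow> bool" where
  "is_union_of_bases m B \<longleftrightarrow>
     (\<exists>S :: nat \<Rightarrow> ('a ^ 'n) set. (\<forall>i<m. is_linear_basis (S i)) \<and> B = (\<Sum>i<m. mset_set (S i)))"

text \<open>
  The copies of \<open>v\<close> in \<open>B\<close> are indexed by \<open>j < count B v\<close>, and \<open>\<alpha> v j\<close> is the
  coefficient of the \<open>j\<close>-th copy.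
\<close>

definition is_combination_with_coeffs_in ::
    "'a::field set \<Rightarrow> ('a ^ 'n) multiset \<Rightarrow> 'a ^ 'n \<Rightarrow> bool" where
  "is_combination_with_coeffs_in A B w \<longleftrightarrow>
     (\<exists>\<alpha> :: 'a ^ 'n \<Rightarrow> nat \<Rightarrow> 'a.
        (\<forall>v\<in>set_mset B. \<forall>j<count B v. \<alpha> v j \<in> A) \<and>
        w = (\<Sum>v\<in>set_mset B. \<Sum>j<count B v. \<alpha> v j *s v))"

end

theory Submission
  imports Defs
begin

text \<open>
  Write \<open>D\<^bsub>v\<^esub> f(x) = f(x) - f(x + v)\<close>; these commuting operators are the factors \<open>1 - g\<^sup>v\<close> of the
  modular group ring, acting on functions. Suppose \<open>\<Prod>\<^bsub>v\<in>S\<^esub> D\<^bsub>v\<^esub>\<^sup>r\<close> kills the indicator of a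
  subspace \<open>W\<close>, while no proper subproduct does. Given any coefficients on \<open>S\<close>, take the step
  sizes \<open>b\<^bsub>v\<^esub>\<close> supplied by arithmeticity; replacing \<open>v\<close> by \<open>b\<^bsub>v\<^esub>v\<close> does not affect vanishing.
  The product over the vectors whose coefficients lie in \<open>A\<close> is nonzero at some point, but the
  full product vanishes there, so some term with a nonzero shift of a bad coefficient cancels.
  Comparing two terms of the good part shifts good coefficients by at most \<open>r\<close> in either direction
  and leaves the sum unchanged modulo \<open>W\<close>, with fewer bad coefficients. Iterating, all coefficients
  on \<open>S\<close> can be moved into \<open>A\<close>.

  Since \<open>D\<^bsub>u\<^esub>\<^sup>p = 0\<close>, more than \<open>(p - 1) codim W\<close> differences always kill the functions periodic
  modulo \<open>W\<close>, and at least \<open>p/r\<close> bases have enough vectors outside a proper \<open>W\<close> for this. So one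
  can extend step by step a subfamily \<open>J\<close> whose combinations with coefficients in \<open>A\<close> cover its
  span \<open>W\<close>, by adjoining a minimal \<open>S\<close> as above from the remaining vectors.
\<close>

section \<open>Difference operators\<close>

definition dif :: "'a::ab_group_add \<Rightarrow> ('a \<Rightarrow> 'b::ab_group_add) \<Rightarrow> 'a \<Rightarrow> 'b" where
  "dif v f = (\<lambda>x. f x - f (x + v))"

definition difs :: "'a::ab_group_add multiset \<Rightarrow> ('a \<Rightarrow> 'b::ab_group_add) \<Rightarrow> 'a \<Rightarrow> 'b" where
  "difs M f = fold_mset dif f M"

interpretation dif: comp_fun_commute dif
  by standard (auto simp: dif_def fun_eq_iff algebra_simps)

lemma difs_empty [simp]: "difs {#} f = f"
  by (simp add: difs_def)

lemma difs_add_mset: "difs (add_mset v M) f = dif v (difs M f)"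
  by (simp add: difs_def)

lemma difs_union: "difs (M + N) f = difs M (difs N f)"
  by (induction M) (simp_all add: difs_add_mset)

lemma difs_add_mset': "difs (add_mset v M) f = difs M (dif v f)"
  using difs_union[of M "{#v#}" f] by (simp add: difs_add_mset)

lemma difs_dif: "difs M (dif v f) = dif v (difs M f)"
  using difs_add_mset[of v M f] difs_add_mset'[of v M f] by simp

lemma difs_zero: "difs M (\<lambda>_. 0) = (\<lambda>_. 0)"
  by (induction M) (simp_all add: difs_add_mset dif_def)

lemma dif_eq_zero_iff: "dif v f = (\<lambda>_. 0) \<longleftrightarrow> (\<forall>x. f (x + v) = f x)"
  by (auto simp: dif_def fun_eq_iff)

lemma difs_periodic:
  assumes "\<And>x. f (x + v) = f x"
  shows "difs M f (x + v) = difs M f x"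
proof -
  have "dif v f = (\<lambda>_. 0)"
    using assms by (simp add: dif_eq_zero_iff)
  then have "dif v (difs M f) = (\<lambda>_. 0)"
    by (metis difs_dif difs_zero)
  then show ?thesis by (simp add: dif_eq_zero_iff)
qed

section \<open>Periods and rescaled steps over the prime field\<close>

lemma ex_of_nat_mod_ring: "\<exists>k. (b :: 'p::prime_card mod_ring) = of_nat k"
proof -
  have "b = of_int (to_int_mod_ring b)"
    by (metis of_int_mod_ring_to_int_mod_ring of_int_of_int_mod_ring)
  moreover have "to_int_mod_ring b \<ge> 0"
    by (transfer) auto
  ultimately show ?thesis
    by (metis of_int_of_nat_eq zero_le_imp_eq_int)
qed

lemma of_nat_card_mod_ring: "of_nat CARD('p) = (0 :: 'p::prime_card mod_ring)"
  by (metis of_int_of_nat_eq of_int_of_int_mod_ring of_int_mod_ring.rep_eq mod_self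
      to_int_mod_ring.rep_eq to_int_mod_ring_hom.eq_iff zero_mod_ring.rep_eq)

text \<open>Every scalar is a natural multiple of 1, so scaling a period is repeated
  addition.\<close>

lemma subspace_periods:
  fixes f :: "'p::prime_card mod_ring ^ 'n \<Rightarrow> 'b"
  shows "vec.subspace {v. \<forall>x. f (x + v) = f x}"
proof (rule vec.subspaceI)
  fix c :: "'p mod_ring" and v
  assume v: "v \<in> {v. \<forall>x. f (x + v) = f x}"
  obtain k where c: "c = of_nat k"
    using ex_of_nat_mod_ring by blast
  have "f (x + of_nat k *s v) = f x" for x
  proof (induction k)
    case (Suc k)
    have "x + of_nat (Suc k) *s v = (x + of_nat k *s v) + v"
      by (simp add: vec.scale_left_distrib algebra_simps)
    then have "f (x + of_nat (Suc k) *s v) = f (x + of_nat k *s v)"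
      using v by (simp only: mem_Collect_eq)
    with Suc show ?case by simp
  qed simp
  then show "c *s v \<in> {v. \<forall>x. f (x + v) = f x}"
    by (simp add: c)
qed (auto simp: add.assoc[symmetric])

text \<open>A vanishing outer difference says that \<open>v\<close> is a period of the remaining
  product, hence so is \<open>b *s v\<close>. The rescaled factor then moves into \<open>N\<close>,
  leaving one copy of \<open>v\<close> fewer for the induction.\<close>

lemma difs_replicate_scale:
  fixes f :: "'p::prime_card mod_ring ^ 'n \<Rightarrow> 'b::ab_group_add"
  assumes "difs (replicate_mset k v + N) f = (\<lambda>_. 0)"
  shows "difs (replicate_mset k (b *s v) + N) f = (\<lambda>_. 0)"
  using assms
proof (induction k arbitrary: N)
  case (Suc k)
  let ?g = "difs (replicate_mset k v + N) f"
  have "v \<in> {v. \<forall>x. ?g (x + v) = ?g x}"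
    using Suc.prems by (simp add: difs_add_mset dif_eq_zero_iff)
  then have "b *s v \<in> {v. \<forall>x. ?g (x + v) = ?g x}"
    by (rule vec.subspace_scale[OF subspace_periods])
  then have "difs (replicate_mset k v + add_mset (b *s v) N) f = (\<lambda>_. 0)"
    by (simp add: difs_add_mset dif_eq_zero_iff)
  then show ?case
    using Suc.IH[of "add_mset (b *s v) N"] by simp
qed simp

lemma difs_sum_scale:
  fixes f :: "'p::prime_card mod_ring ^ 'n \<Rightarrow> 'b::ab_group_add"
  assumes "finite S" "difs ((\<Sum>i\<in>S. replicate_mset r (c i)) + N) f = (\<lambda>_. 0)"
  shows "difs ((\<Sum>i\<in>S. replicate_mset r (b i *s c i)) + N) f = (\<lambda>_. 0)"
  using assms
proof (induction S arbitrary: N)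
  case (insert i S)
  have "difs (replicate_mset r (b i *s c i) + ((\<Sum>i\<in>S. replicate_mset r (c i)) + N)) f = (\<lambda>_. 0)"
    using insert by (intro difs_replicate_scale) (simp add: ac_simps)
  then show ?case
    using insert.IH[of "replicate_mset r (b i *s c i) + N"] insert.hyps by (simp add: ac_simps)
qed simp

section \<open>Locating nonzero terms in an expanded product\<close>

lemma difs_replicate_eq_zero:
  fixes f :: "'p::prime_card mod_ring ^ 'n \<Rightarrow> 'b::ab_group_add"
  assumes "\<And>i. i \<le> k \<Longrightarrow> f (y + of_nat i *s v) = 0"
  shows "difs (replicate_mset k v) f y = 0"
  using assms
proof (induction k arbitrary: f)
  case 0
  then show ?case using "0"[of 0] by simp
next
  case (Suc k)
  have "dif v f (y + of_nat i *s v) = 0" if "i \<le> k" for i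
    using Suc.prems[of i] Suc.prems[of "Suc i"] that
    by (simp add: dif_def vec.scale_left_distrib algebra_simps)
  then show ?case
    using Suc.IH by (simp add: difs_add_mset')
qed

text \<open>In the expansion of \<open>(1 - g)^k\<close>, where \<open>g\<close> shifts by
  \<open>v\<close>, the unshifted term has coefficient 1 and is the only one left.\<close>

lemma difs_replicate_eq_self:
  fixes f :: "'p::prime_card mod_ring ^ 'n \<Rightarrow> 'b::ab_group_add"
  assumes "\<And>i. i \<in> {1..k} \<Longrightarrow> f (y + of_nat i *s v) = 0"
  shows "difs (replicate_mset k v) f y = f y"
  using assms
proof (induction k arbitrary: f)
  case (Suc k)
  have "dif v f (y + of_nat i *s v) = 0" if "i \<in> {1..k}" for i
    using Suc.prems[of i] Suc.prems[of "Suc i"] that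
    by (simp add: dif_def vec.scale_left_distrib algebra_simps)
  moreover have "dif v f y = f y"
    using Suc.prems[of 1] by (simp add: dif_def)
  ultimately show ?case
    using Suc.IH[of "dif v f"] by (simp add: difs_add_mset')
qed simp

text \<open>The value at \<open>y\<close> combines values of \<open>f\<close> at points reached by
  at most \<open>r\<close> copies of each step, so one of these must be nonzero.\<close>

lemma difs_sum_neq_zeroE:
  fixes f :: "'p::prime_card mod_ring ^ 'n \<Rightarrow> 'b::ab_group_add"
  assumes "finite S" "difs (\<Sum>i\<in>S. replicate_mset r (c i)) f y \<noteq> 0"
  obtains k where "\<And>i. k i \<le> r" "f (y + (\<Sum>i\<in>S. of_nat (k i) *s c i)) \<noteq> 0"
proof -
  have "\<exists>k. (\<forall>i. k i \<le> r) \<and> f (y + (\<Sum>i\<in>S. of_nat (k i) *s c i)) \<noteq> 0"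
    using assms
  proof (induction S arbitrary: y)
    case empty
    then show ?case by auto
  next
    case (insert i S)
    let ?g = "difs (\<Sum>i\<in>S. replicate_mset r (c i)) f"
    have "difs (replicate_mset r (c i)) ?g y \<noteq> 0"
      using insert by (simp add: difs_union)
    then obtain j where j: "j \<le> r" "?g (y + of_nat j *s c i) \<noteq> 0"
      using difs_replicate_eq_zero by blast
    obtain k where k: "\<forall>i. k i \<le> r"
      "f (y + of_nat j *s c i + (\<Sum>i\<in>S. of_nat (k i) *s c i)) \<noteq> 0"
      using insert.IH[OF j(2)] by blast
    have "(\<Sum>l\<in>S. of_nat ((k(i := j)) l) *s c l) = (\<Sum>l\<in>S. of_nat (k l) *s c l)"
      using insert.hyps by (intro sum.cong) auto
    then show ?case
      using j(1) k insert.hyps by (intro exI[of _ "k(i := j)"]) (simp add: add.assoc)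
  qed
  with that show ?thesis by blast
qed

text \<open>The unshifted term \<open>f y\<close> has coefficient 1, so cancelling it takes a
  nonzero term with a genuine shift.\<close>

lemma difs_sum_eq_zeroE:
  fixes f :: "'p::prime_card mod_ring ^ 'n \<Rightarrow> 'b::ab_group_add"
  assumes "finite S" "difs (\<Sum>i\<in>S. replicate_mset r (c i)) f y = 0" "f y \<noteq> 0"
  obtains k where "\<And>i. k i \<le> r" "\<exists>i\<in>S. k i \<ge> 1"
    "f (y + (\<Sum>i\<in>S. of_nat (k i) *s c i)) \<noteq> 0"
proof -
  have "\<exists>k. (\<forall>i. k i \<le> r) \<and> (\<exists>i\<in>S. k i \<ge> 1) \<and> f (y + (\<Sum>i\<in>S. of_nat (k i) *s c i)) \<noteq> 0"
    using assms
  proof (induction S)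
    case empty
    then show ?case by simp
  next
    case (insert i S)
    let ?g = "difs (\<Sum>i\<in>S. replicate_mset r (c i)) f"
    have upd: "(\<Sum>l\<in>S. of_nat ((k(i := j)) l) *s c l) = (\<Sum>l\<in>S. of_nat (k l) *s c l)" for k j
      using insert.hyps by (intro sum.cong) auto
    \<comment> \<open>If the product over \<open>S\<close> already vanishes at \<open>y\<close>, the
      shift comes from \<open>S\<close> and \<open>k i = 0\<close>; otherwise the \<open>r\<close>
      copies of \<open>c i\<close> must cancel a nonzero value, which forces a shift
      \<open>j >= 1\<close>.\<close>
    show ?case
    proof (cases "?g y = 0")
      case True
      then obtain k where k: "\<forall>i. k i \<le> r" "\<exists>i\<in>S. k i \<ge> 1"
        "f (y + (\<Sum>i\<in>S. of_nat (k i) *s c i)) \<noteq> 0"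
        using insert by blast
      then show ?thesis
        using upd[of k 0] insert.hyps by (intro exI[of _ "k(i := 0)"]) auto
    next
      case False
      have "difs (replicate_mset r (c i)) ?g y = 0"
        using insert by (simp add: difs_union)
      then obtain j where j: "j \<in> {1..r}" "?g (y + of_nat j *s c i) \<noteq> 0"
        using difs_replicate_eq_self[of r ?g y "c i"] False by metis
      obtain k where k: "\<And>i. k i \<le> r"
        "f (y + of_nat j *s c i + (\<Sum>i\<in>S. of_nat (k i) *s c i)) \<noteq> 0"
        using difs_sum_neq_zeroE[OF insert.hyps(1) j(2)] by blast
      then show ?thesis
        using upd[of k j] j(1) insert.hyps by (intro exI[of _ "k(i := j)"]) (simp add: add.assoc)
    qed
  qed
  with that show ?thesis by blast
qed

section \<open>Products of many differences vanish\<close>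

lemma difs_replicate_binomial:
  fixes f :: "'p::prime_card mod_ring ^ 'n \<Rightarrow> 'b::comm_ring_1"
  shows "difs (replicate_mset k v) f y
    = (\<Sum>i\<le>k. (- 1) ^ i * of_nat (k choose i) * f (y + of_nat i *s v))"
proof (induction k arbitrary: y)
  case (Suc k)
  let ?h = "\<lambda>i. f (y + of_nat i *s v)"
  have "difs (replicate_mset (Suc k) v) f y
      = (\<Sum>i\<le>k. (- 1) ^ i * of_nat (k choose i) * ?h i)
      - (\<Sum>i\<le>k. (- 1) ^ i * of_nat (k choose i) * ?h (Suc i))"
    by (simp add: difs_add_mset dif_def Suc vec.scale_left_distrib algebra_simps)
  also have "(\<Sum>i\<le>k. (- 1) ^ i * of_nat (k choose i) * ?h i)
      = ?h 0 + (\<Sum>i\<le>k. (- 1) ^ Suc i * of_nat (k choose Suc i) * ?h (Suc i))"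
    using sum.atMost_Suc_shift[of "\<lambda>i. (- 1) ^ i * of_nat (k choose i) * ?h i" k]
    by (simp add: binomial_eq_0)
  also have "\<dots> - (\<Sum>i\<le>k. (- 1) ^ i * of_nat (k choose i) * ?h (Suc i))
      = (\<Sum>i\<le>Suc k. (- 1) ^ i * of_nat (Suc k choose i) * ?h i)"
    unfolding sum.atMost_Suc_shift[of _ k]
    by (simp add: sum_negf sum_subtractf sum.distrib algebra_simps)
  finally show ?case .
qed simp

text \<open>Since \<open>p\<close> divides the inner binomial coefficients,
  \<open>(1 - g)^p = 1 - g^p\<close>, and \<open>g^p\<close> shifts by
  \<open>p v = 0\<close>.\<close>

lemma difs_replicate_card:
  fixes f :: "'p::prime_card mod_ring ^ 'n \<Rightarrow> 'p mod_ring"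
  shows "difs (replicate_mset CARD('p) v) f = (\<lambda>_. 0)"
proof
  fix y
  let ?p = "CARD('p)"
  let ?t = "\<lambda>i. (- 1) ^ i * of_nat (?p choose i) * f (y + of_nat i *s v)"
  have p: "prime ?p" by (rule prime_card)
  have zero: "?t i = 0" if "i \<in> {..?p} - {0, ?p}" for i
  proof -
    have "?p dvd (?p choose i)"
      using that p by (intro dvd_choose_prime) (auto simp: prime_gt_0_nat)
    then have "of_nat (?p choose i) = (0 :: 'p mod_ring)"
      by (metis dvdE mult_zero_left of_nat_card_mod_ring of_nat_mult)
    then show ?thesis by simp
  qed
  \<comment> \<open>The sign of the last term; for \<open>p = 2\<close> it is right only because
    \<open>-1 = 1\<close>.\<close>
  have "(- 1 :: 'p mod_ring) ^ ?p = - 1"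
  proof (cases "?p = 2")
    case True
    then have "(1 :: 'p mod_ring) + 1 = 0"
      using of_nat_card_mod_ring[where 'p = 'p] by simp
    then have "(- 1 :: 'p mod_ring) = 1" by (rule minus_unique)
    then show ?thesis by (simp only: power_one)
  next
    case False
    then have "odd ?p" using primes_dvd_imp_eq[OF two_is_prime_nat p] by auto
    then show ?thesis by simp
  qed
  moreover have "(\<Sum>i\<le>?p. ?t i) = (\<Sum>i\<in>{0, ?p}. ?t i)"
    using zero by (intro sum.mono_neutral_right) auto
  ultimately show "difs (replicate_mset ?p v) f y = 0"
    using p unfolding difs_replicate_binomial
    by (simp add: of_nat_card_mod_ring del: vec.scale_eq_0_iff)
qed

text \<open>The periods of \<open>difs L f\<close> form a subspace containing both \<open>U\<close>
  and \<open>W\<close>, hence every \<open>v\<close>; so steps from \<open>U\<close> can be traded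
  for arbitrary ones.\<close>

lemma difs_eq_zero_if_spanning:
  fixes f :: "'p::prime_card mod_ring ^ 'n \<Rightarrow> 'b::ab_group_add"
  assumes "vec.span (U \<union> W) = UNIV" "\<And>w x. w \<in> W \<Longrightarrow> f (x + w) = f x"
    and "\<And>M. set_mset M \<subseteq> U \<Longrightarrow> size M = N \<Longrightarrow> difs M f = (\<lambda>_. 0)"
    and "size M = N"
  shows "difs M f = (\<lambda>_. 0)"
  using assms(2-4)
proof (induction N arbitrary: f M)
  case (Suc N)
  obtain v L where M: "M = add_mset v L" "size L = N"
    using size_eq_Suc_imp_eq_union[OF Suc.prems(3)] Suc.prems(3) by auto
  let ?g = "difs L f"
  let ?P = "{v. \<forall>x. ?g (x + v) = ?g x}"
  \<comment> \<open>\<open>dif u f\<close> is again periodic along \<open>W\<close> and is killed by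
    any \<open>N\<close> steps from \<open>U\<close>, so the induction hypothesis applies to
    it.\<close>
  have "difs L (dif u f) = (\<lambda>_. 0)" if "u \<in> U" for u
  proof (rule Suc.IH[OF _ _ M(2)])
    fix K assume "set_mset K \<subseteq> U" "size K = N"
    with that have "difs (add_mset u K) f = (\<lambda>_. 0)"
      by (intro Suc.prems(2)) auto
    then show "difs K (dif u f) = (\<lambda>_. 0)" by (simp add: difs_add_mset')
  next
    fix w x assume "w \<in> W"
    then show "dif u f (x + w) = dif u f x"
      using Suc.prems(1)[of w] by (simp add: dif_def) (metis add.commute add.left_commute)
  qed
  then have "dif u ?g = (\<lambda>_. 0)" if "u \<in> U" for u
    using that by (simp only: difs_dif)
  then have "U \<subseteq> ?P"
    by (auto simp: dif_eq_zero_iff)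
  moreover have "W \<subseteq> ?P"
    using Suc.prems(1) difs_periodic by blast
  ultimately have "vec.span (U \<union> W) \<subseteq> ?P"
    by (intro vec.span_minimal subspace_periods) auto
  then have "v \<in> ?P" using assms(1) by blast
  then show ?case by (simp add: M difs_add_mset dif_eq_zero_iff)
qed simp

text \<open>Pigeonhole: more than \<open>(p - 1) * card U\<close> steps taken from \<open>U\<close>
  repeat some step \<open>p\<close> times, and these copies alone give zero.\<close>

lemma difs_eq_zero_if_size:
  fixes f :: "'p::prime_card mod_ring ^ 'n \<Rightarrow> 'p mod_ring"
  assumes "finite U" "vec.span (U \<union> W) = UNIV" "\<And>w x. w \<in> W \<Longrightarrow> f (x + w) = f x"
    and "size M > (CARD('p) - 1) * card U"
  shows "difs M f = (\<lambda>_. 0)"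
proof (rule difs_eq_zero_if_spanning[OF assms(2,3) _ refl])
  fix K :: "('p mod_ring ^ 'n) multiset"
  assume K: "set_mset K \<subseteq> U" "size K = size M"
  have "\<exists>u\<in>U. count K u \<ge> CARD('p)"
  proof (rule ccontr)
    assume "\<not> ?thesis"
    then have "count K u \<le> CARD('p) - 1" if "u \<in> U" for u
      using that by fastforce
    then have "(\<Sum>u\<in>U. count K u) \<le> (CARD('p) - 1) * card U"
      using sum_bounded_above[of U "count K" "CARD('p) - 1"] by (simp add: mult.commute)
    moreover have "size K = (\<Sum>u\<in>U. count K u)"
      unfolding size_multiset_overloaded_eq using K(1) assms(1)
      by (intro sum.mono_neutral_left) (auto simp: count_eq_zero_iff)
    ultimately show False using assms(4) K(2) by simp
  qed
  then obtain u where "replicate_mset CARD('p) u \<subseteq># K"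
    using count_le_replicate_mset_subset_eq by metis
  then obtain L where "K = replicate_mset CARD('p) u + L"
    by (metis subset_mset.add_diff_inverse)
  then show "difs K f = (\<lambda>_. 0)"
    by (simp add: difs_union difs_replicate_card)
qed auto

section \<open>Moving coefficients into an arithmetic set\<close>

text \<open>Merges the two clauses so that a single step serves each coefficient: forward moves
  always, backward moves only from inside \<open>A\<close>.\<close>

lemma r_arithmetic_stepE:
  assumes "r_arithmetic r A"
  obtains b where "b \<noteq> 0"
    "\<And>i. i \<in> {1..int r} \<Longrightarrow> a + of_int i * b \<in> A"
    "\<And>i. a \<in> A \<Longrightarrow> i \<in> {- int r..int r} \<Longrightarrow> a + of_int i * b \<in> A"
proof (cases "a \<in> A")
  case True
  then obtain b where "b \<noteq> 0" "\<forall>i\<in>{- int r..int r}. a + of_int i * b \<in> A"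
    using assms unfolding r_arithmetic_def by blast
  then show ?thesis by (intro that[of b]) auto
next
  case False
  then obtain b where "b \<noteq> 0" "\<forall>i\<in>{1..int r}. a + of_int i * b \<in> A"
    using assms unfolding r_arithmetic_def by blast
  then show ?thesis using False by (intro that[of b]) auto
qed

text \<open>From one \<open>y\<close>, two points of \<open>W\<close> are reached, one by shifts
  along good vectors only and one with a genuine shift along a bad vector; their difference gives
  the change of coefficients.\<close>

lemma fewer_bad_coefficients:
  fixes x :: "'i \<Rightarrow> 'p::prime_card mod_ring ^ 'n" and a :: "'i \<Rightarrow> 'p mod_ring"
  assumes A: "r_arithmetic r A" and S: "finite S" and W: "vec.subspace W"
    and zero: "difs (\<Sum>i\<in>S. replicate_mset r (x i)) (indicator W :: _ \<Rightarrow> 'p mod_ring) = (\<lambda>_. 0)"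
    and nonzero: "\<And>T. T \<subset> S \<Longrightarrow>
      difs (\<Sum>i\<in>T. replicate_mset r (x i)) (indicator W :: _ \<Rightarrow> 'p mod_ring) \<noteq> (\<lambda>_. 0)"
    and bad: "\<exists>i\<in>S. a i \<notin> A"
  obtains a' where "{i\<in>S. a' i \<notin> A} \<subset> {i\<in>S. a i \<notin> A}"
    "(\<Sum>i\<in>S. a' i *s x i) - (\<Sum>i\<in>S. a i *s x i) \<in> W"
proof -
  define Bad where "Bad = {i\<in>S. a i \<notin> A}"
  define Good where "Good = S - Bad"
  let ?f = "indicator W :: _ \<Rightarrow> 'p mod_ring"
  have fin: "finite Bad" "finite Good" and S_eq: "S = Bad \<union> Good" "Bad \<inter> Good = {}"
    using S by (auto simp: Bad_def Good_def)
  have "\<forall>i. \<exists>b. b \<noteq> 0 \<and> (\<forall>j\<in>{1..int r}. a i + of_int j * b \<in> A) \<and>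
      (a i \<in> A \<longrightarrow> (\<forall>j\<in>{- int r..int r}. a i + of_int j * b \<in> A))"
    using r_arithmetic_stepE[OF A] by metis
  then obtain b where b: "\<And>i. b i \<noteq> 0" "\<And>i j. j \<in> {1..int r} \<Longrightarrow> a i + of_int j * b i \<in> A"
    "\<And>i j. a i \<in> A \<Longrightarrow> j \<in> {- int r..int r} \<Longrightarrow> a i + of_int j * b i \<in> A"
    by metis
  define c where "c i = b i *s x i" for i
  let ?g = "difs (\<Sum>i\<in>Good. replicate_mset r (c i)) ?f"
  \<comment> \<open>\<open>Good\<close> is a proper subset of \<open>S\<close>; dividing out the
    nonzero \<open>b i\<close> would turn vanishing for \<open>c\<close> into vanishing for
    \<open>x\<close>, against \<open>nonzero\<close>.\<close>
  have "?g \<noteq> (\<lambda>_. 0)"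
  proof
    assume "?g = (\<lambda>_. 0)"
    then have "difs (\<Sum>i\<in>Good. replicate_mset r (inverse (b i) *s c i)) ?f = (\<lambda>_. 0)"
      using difs_sum_scale[OF fin(2), of r c "{#}" ?f "\<lambda>i. inverse (b i)"] by simp
    then show False
      using nonzero[of Good] bad b(1) by (auto simp: c_def Good_def Bad_def)
  qed
  then obtain y where y: "?g y \<noteq> 0" by blast
  obtain j where j: "\<And>i. j i \<le> r" "y + (\<Sum>i\<in>Good. of_nat (j i) *s c i) \<in> W"
    using difs_sum_neq_zeroE[OF fin(2) y] by (auto simp: indicator_def split: if_splits)
  have "difs (\<Sum>i\<in>S. replicate_mset r (c i)) ?f = (\<lambda>_. 0)"
    using difs_sum_scale[OF S, of r x "{#}" ?f b] zero by (simp add: c_def)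
  then have zero_Bad: "difs (\<Sum>i\<in>Bad. replicate_mset r (c i)) ?g y = 0"
    unfolding S_eq by (simp add: sum.union_disjoint fin S_eq difs_union)
  obtain k where k: "\<And>i. k i \<le> r" "\<exists>i\<in>Bad. k i \<ge> 1"
      "?g (y + (\<Sum>i\<in>Bad. of_nat (k i) *s c i)) \<noteq> 0"
    by (rule difs_sum_eq_zeroE[of Bad r c ?g y, OF fin(1) zero_Bad y]) (rule that)
  obtain l where l: "\<And>i. l i \<le> r"
      "y + (\<Sum>i\<in>Bad. of_nat (k i) *s c i) + (\<Sum>i\<in>Good. of_nat (l i) *s c i) \<in> W"
    using difs_sum_neq_zeroE[OF fin(2) k(3)] by (auto simp: indicator_def split: if_splits)
  \<comment> \<open>Bad coefficients move forward by \<open>k i\<close>, landing in \<open>A\<close>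
    unless \<open>k i = 0\<close>; good ones move by a difference of two numbers in
    \<open>[0, r]\<close>, so they stay in \<open>A\<close>.\<close>
  define a' where "a' i = a i + of_int (if i \<in> Bad then int (k i) else int (l i) - int (j i)) * b i" for i
  have good: "a' i \<in> A" if "i \<in> Good" for i
  proof -
    have "int (l i) - int (j i) \<in> {- int r..int r}"
      using l(1)[of i] j(1)[of i] by auto
    moreover have "a i \<in> A" "i \<notin> Bad" using that by (auto simp: Good_def Bad_def)
    ultimately show ?thesis using b(3) unfolding a'_def by presburger
  qed
  obtain i0 where i0: "i0 \<in> Bad" "k i0 \<ge> 1" using k(2) by blast
  have "a' i0 \<in> A"
    using b(2)[of "int (k i0)" i0] i0 k(1)[of i0] by (simp add: a'_def)
  with i0 good have "{i\<in>S. a' i \<notin> A} \<subset> Bad"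
    unfolding S_eq by blast
  moreover have "(\<Sum>i\<in>S. a' i *s x i) - (\<Sum>i\<in>S. a i *s x i) = (\<Sum>i\<in>S. (a' i - a i) *s x i)"
    by (simp add: sum_subtractf vec.scale_left_diff_distrib)
  moreover have "\<dots> = (\<Sum>i\<in>Bad. of_nat (k i) *s c i)
      + ((\<Sum>i\<in>Good. of_nat (l i) *s c i) - (\<Sum>i\<in>Good. of_nat (j i) *s c i))"
  proof -
    have "(\<Sum>i\<in>Bad. (a' i - a i) *s x i) = (\<Sum>i\<in>Bad. of_nat (k i) *s c i)"
      by (intro sum.cong) (auto simp: a'_def c_def)
    moreover have "(\<Sum>i\<in>Good. (a' i - a i) *s x i)
        = (\<Sum>i\<in>Good. of_nat (l i) *s c i - of_nat (j i) *s c i)"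
      by (intro sum.cong)
        (auto simp: a'_def c_def Good_def vec.scale_left_diff_distrib left_diff_distrib)
    ultimately show ?thesis
      unfolding S_eq(1) by (simp only: sum.union_disjoint[OF fin S_eq(2)] sum_subtractf)
  qed
  \<comment> \<open>Subtracting the two memberships in \<open>W\<close> cancels
    \<open>y\<close>.\<close>
  moreover have "\<dots> \<in> W"
    using vec.subspace_diff[OF W l(2) j(2)] by (simp add: algebra_simps)
  ultimately show ?thesis
    using that[of a'] unfolding Bad_def by simp
qed

text \<open>Descent on the number of bad coefficients; the errors add up inside the subspace
  \<open>W\<close>.\<close>

lemma no_bad_coefficients:
  fixes x :: "'i \<Rightarrow> 'p::prime_card mod_ring ^ 'n" and a :: "'i \<Rightarrow> 'p mod_ring"
  assumes "r_arithmetic r A" and S: "finite S" and W: "vec.subspace W"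
    and "difs (\<Sum>i\<in>S. replicate_mset r (x i)) (indicator W :: _ \<Rightarrow> 'p mod_ring) = (\<lambda>_. 0)"
    and "\<And>T. T \<subset> S \<Longrightarrow>
      difs (\<Sum>i\<in>T. replicate_mset r (x i)) (indicator W :: _ \<Rightarrow> 'p mod_ring) \<noteq> (\<lambda>_. 0)"
  shows "\<exists>a'. (\<forall>i\<in>S. a' i \<in> A) \<and> (\<Sum>i\<in>S. a' i *s x i) - (\<Sum>i\<in>S. a i *s x i) \<in> W"
proof (induction "card {i\<in>S. a i \<notin> A}" arbitrary: a rule: less_induct)
  case less
  show ?case
  proof (cases "\<exists>i\<in>S. a i \<notin> A")
    case True
    obtain a1 where a1: "{i\<in>S. a1 i \<notin> A} \<subset> {i\<in>S. a i \<notin> A}"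
      "(\<Sum>i\<in>S. a1 i *s x i) - (\<Sum>i\<in>S. a i *s x i) \<in> W"
      using fewer_bad_coefficients[OF assms True] by blast
    have "card {i\<in>S. a1 i \<notin> A} < card {i\<in>S. a i \<notin> A}"
      using a1(1) S by (intro psubset_card_mono) auto
    then obtain a2 where a2: "\<forall>i\<in>S. a2 i \<in> A"
      "(\<Sum>i\<in>S. a2 i *s x i) - (\<Sum>i\<in>S. a1 i *s x i) \<in> W"
      using less by blast
    then show ?thesis
      using vec.subspace_add[OF W a2(2) a1(2)] by auto
  next
    case False
    then show ?thesis
      using vec.subspace_0[OF W] by (intro exI[of _ a]) auto
  qed
qed

section \<open>Enlarging a representable subfamily\<close>

lemma r_arithmetic_nonempty:
  assumes "r_arithmetic r A" "r > 0"
  shows "A \<noteq> {}"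
  using r_arithmetic_stepE[OF assms(1)] assms(2)
  by (metis atLeastAtMost_iff empty_iff int_one_le_iff_zero_less of_nat_0_less_iff order_refl)

text \<open>Coefficients are attached to indices, not to vectors, since \<open>x\<close> may repeat
  vectors on \<open>S\<close>.\<close>

lemma span_imageE:
  fixes x :: "'i \<Rightarrow> 'a::field ^ 'n"
  assumes "finite S" "w \<in> vec.span (x ` S)"
  obtains a where "w = (\<Sum>i\<in>S. a i *s x i)"
proof -
  let ?R = "range (\<lambda>a. \<Sum>i\<in>S. a i *s x i)"
  have "vec.span (x ` S) \<subseteq> ?R"
  proof (rule vec.span_minimal)
    show "x ` S \<subseteq> ?R"
    proof clarify
      fix i assume "i \<in> S"
      then have "x i = (\<Sum>l\<in>S. (if l = i then 1 else 0) *s x l)"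
        using assms(1) by (simp add: if_distrib[of "\<lambda>c. c *s _"] cong: if_cong)
      then show "x i \<in> ?R" by (rule range_eqI[of _ _ "\<lambda>l. if l = i then 1 else 0"])
    qed
    show "vec.subspace ?R"
    proof (rule vec.subspaceI)
      show "0 \<in> ?R" by (rule range_eqI[of _ _ "\<lambda>_. 0"]) simp
    next
      fix u v assume "u \<in> ?R" "v \<in> ?R"
      then obtain a b where "u = (\<Sum>i\<in>S. a i *s x i)" "v = (\<Sum>i\<in>S. b i *s x i)"
        by blast
      then show "u + v \<in> ?R"
        by (intro range_eqI[of _ _ "\<lambda>i. a i + b i"])
          (simp add: vec.scale_left_distrib sum.distrib)
    next
      fix c v assume "v \<in> ?R"
      then obtain a where "v = (\<Sum>i\<in>S. a i *s x i)"
        by blast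
      then show "c *s v \<in> ?R"
        by (intro range_eqI[of _ _ "\<lambda>i. c * a i"]) (simp add: vec.scale_sum_right)
    qed
  qed
  with assms(2) that show ?thesis by blast
qed

lemma filter_mset_sum:
  "filter_mset P (\<Sum>i\<in>K. M i) = (\<Sum>i\<in>K. filter_mset P (M i))"
  by (induction K rule: infinite_finite_induct) auto

text \<open>\<open>U\<close> consists of the vectors extending a basis of \<open>W\<close> to one of
  the whole space; its size feeds the pigeonhole bound.\<close>

lemma complement_dim:
  fixes W :: "('a::field ^ 'n) set"
  assumes "vec.subspace W"
  obtains U where "finite U" "vec.span (U \<union> W) = UNIV" "card U = CARD('n) - vec.dim W"
proof -
  obtain C where C: "C \<subseteq> W" "vec.independent C" "W \<subseteq> vec.span C" "card C = vec.dim W"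
    using vec.basis_exists by metis
  obtain D where D: "C \<subseteq> D" "vec.independent D" "UNIV \<subseteq> vec.span D"
    using vec.maximal_independent_subset_extend[of C UNIV] C by (metis subset_UNIV)
  have fin: "finite C" "finite D"
    using C(2) D(2) vec.finiteI_independent by blast+
  have "card D = CARD('n)"
    using vec.dim_eq_card_independent[OF D(2)] D(3)
    by (metis top.extremum_uniqueI vec.dim_span vec_dim_card)
  then have "card (D - C) = CARD('n) - vec.dim W"
    using D(1) C(4) fin by (simp add: card_Diff_subset)
  moreover have "vec.span ((D - C) \<union> W) = UNIV"
  proof -
    have "D \<subseteq> (D - C) \<union> W" using C(1) by blast
    from vec.span_mono[OF this] D(3) show ?thesis by blast
  qed
  ultimately show ?thesis using that fin by blast
qed

text \<open>Induction on the number of indices outside \<open>J\<close>. As long as the span of the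
  \<open>J\<close>-vectors is proper, \<open>many\<close> leaves enough steps outside
  \<open>J\<close> to kill its indicator.\<close>

lemma representable_aux:
  fixes x :: "'i \<Rightarrow> 'p::prime_card mod_ring ^ 'n"
  assumes A: "r_arithmetic r A" "r > 0" and I: "finite I"
    and many: "\<And>W. vec.subspace W \<Longrightarrow> W \<noteq> UNIV \<Longrightarrow>
      (CARD('p) - 1) * (CARD('n) - vec.dim W) < r * card {i\<in>I. x i \<notin> W}"
    and J: "J \<subseteq> I"
    and rep: "\<And>w. w \<in> vec.span (x ` J) \<Longrightarrow> \<exists>\<alpha>. (\<forall>i\<in>J. \<alpha> i \<in> A) \<and> w = (\<Sum>i\<in>J. \<alpha> i *s x i)"
  shows "\<exists>\<alpha>. (\<forall>i\<in>I. \<alpha> i \<in> A) \<and> w = (\<Sum>i\<in>I. \<alpha> i *s x i)"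
  using J rep
proof (induction "card (I - J)" arbitrary: J rule: less_induct)
  case less
  define W where "W = vec.span (x ` J)"
  have W: "vec.subspace W" by (simp add: W_def vec.subspace_span)
  have finJ: "finite J" using less.prems(1) I finite_subset by blast
  show ?case
  proof (cases "W = UNIV")
    case True
    \<comment> \<open>Once \<open>J\<close> spans everything, the other indices take the constant
      \<open>a0\<close> and \<open>J\<close> absorbs what remains.\<close>
    obtain a0 where a0: "a0 \<in> A" using r_arithmetic_nonempty[OF A] by blast
    obtain \<alpha> where \<alpha>: "\<forall>i\<in>J. \<alpha> i \<in> A" "w - (\<Sum>i\<in>I - J. a0 *s x i) = (\<Sum>i\<in>J. \<alpha> i *s x i)"
      using less.prems(2) True unfolding W_def by blast
    let ?\<beta> = "\<lambda>i. if i \<in> J then \<alpha> i else a0"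
    have "(\<Sum>i\<in>I. ?\<beta> i *s x i) = (\<Sum>i\<in>I - J. ?\<beta> i *s x i) + (\<Sum>i\<in>J. ?\<beta> i *s x i)"
      using I less.prems(1) by (rule sum.subset_diff[rotated])
    also have "\<dots> = (\<Sum>i\<in>I - J. a0 *s x i) + (\<Sum>i\<in>J. \<alpha> i *s x i)"
      by (intro arg_cong2[of _ _ _ _ "(+)"] sum.cong) auto
    also have "\<dots> = w" using \<alpha>(2) by (simp add: algebra_simps)
    finally show ?thesis using \<alpha>(1) a0 by (intro exI[of _ ?\<beta>]) auto
  next
    case False
    let ?f = "indicator W :: _ \<Rightarrow> 'p mod_ring"
    let ?Z = "\<lambda>S. S \<subseteq> I - J \<and> difs (\<Sum>i\<in>S. replicate_mset r (x i)) ?f = (\<lambda>_. 0)"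
    obtain U where U: "finite U" "vec.span (U \<union> W) = UNIV" "card U = CARD('n) - vec.dim W"
      using complement_dim[OF W] by blast
    have "?Z (I - J)"
    proof (intro conjI difs_eq_zero_if_size[OF U(1,2)])
      fix w y assume "w \<in> W"
      then show "?f (y + w) = ?f y"
        using vec.subspace_add[OF W] vec.subspace_diff[OF W] 
        by (metis add_diff_cancel_right' indicator_simps)
    next
      \<comment> \<open>Vectors indexed by \<open>J\<close> lie in \<open>W\<close>, so every index
        counted by \<open>many\<close> is in \<open>I - J\<close>.\<close>
      have "x i \<in> W" if "i \<in> J" for i
        using that by (simp add: W_def vec.span_base)
      then have "card {i\<in>I. x i \<notin> W} \<le> card (I - J)"
        using I by (intro card_mono) auto
      then have "r * card {i\<in>I. x i \<notin> W} \<le> r * card (I - J)"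
        by (rule mult_le_mono2)
      moreover have "size (\<Sum>i\<in>I - J. replicate_mset r (x i)) = r * card (I - J)"
        by (simp add: size_multiset_sum)
      ultimately show "(CARD('p) - 1) * card U < size (\<Sum>i\<in>I - J. replicate_mset r (x i))"
        using many[OF W False] unfolding U(3) by linarith
    qed simp
    \<comment> \<open>Minimality makes every proper subproduct nonzero, as
      \<open>no_bad_coefficients\<close> requires.\<close>
    then obtain S where S: "?Z S" and minS: "\<And>T. T \<subset> S \<Longrightarrow> \<not> ?Z T"
    proof -
      have "finite {S. ?Z S}" "{S. ?Z S} \<noteq> {}"
        using I \<open>?Z (I - J)\<close> by (auto intro: finite_subset[of _ "Pow I"])
      from finite_has_minimal[OF this] obtain S where
        "?Z S" "\<And>T. ?Z T \<Longrightarrow> T \<subseteq> S \<Longrightarrow> S = T"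
        by auto
      then show ?thesis by (intro that) blast+
    qed
    have finS: "finite S" using S I finite_subset by blast
    \<comment> \<open>The empty product leaves the indicator, which is 1 at 0; hence
      \<open>J\<close> really grows.\<close>
    have "S \<noteq> {}"
    proof
      assume "S = {}"
      with S have "?f 0 = 0" by (simp add: fun_eq_iff)
      then show False using vec.subspace_0[OF W] by simp
    qed
    have disj: "J \<inter> S = {}" using S by auto
    show ?thesis
    proof (rule less.hyps)
      show "card (I - (J \<union> S)) < card (I - J)"
        using S \<open>S \<noteq> {}\<close> I by (intro psubset_card_mono) auto
      show "J \<union> S \<subseteq> I" using S less.prems(1) by auto
    next
      fix w assume "w \<in> vec.span (x ` (J \<union> S))"
      then obtain w0 w1 where w: "w = w0 + w1" "w0 \<in> W" "w1 \<in> vec.span (x ` S)"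
        unfolding W_def image_Un vec.span_Un by auto
      obtain a where a: "w1 = (\<Sum>i\<in>S. a i *s x i)"
        using span_imageE[OF finS w(3)] by blast
      \<comment> \<open>\<open>S\<close> represents \<open>w1\<close> only modulo \<open>W\<close>;
        the error joins \<open>w0\<close> and is absorbed by \<open>J\<close>.\<close>
      obtain a' where a': "\<forall>i\<in>S. a' i \<in> A" "(\<Sum>i\<in>S. a' i *s x i) - w1 \<in> W"
        using no_bad_coefficients[OF A(1) finS W, of x a] S minS a by blast
      have "w - (\<Sum>i\<in>S. a' i *s x i) \<in> W"
        using vec.subspace_diff[OF W w(2) a'(2)] by (simp add: w(1) algebra_simps)
      then obtain \<alpha> where \<alpha>: "\<forall>i\<in>J. \<alpha> i \<in> A" "w - (\<Sum>i\<in>S. a' i *s x i) = (\<Sum>i\<in>J. \<alpha> i *s x i)"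
        using less.prems(2) unfolding W_def by blast
      let ?\<beta> = "\<lambda>i. if i \<in> J then \<alpha> i else a' i"
      have "(\<Sum>i\<in>J \<union> S. ?\<beta> i *s x i) = (\<Sum>i\<in>J. ?\<beta> i *s x i) + (\<Sum>i\<in>S. ?\<beta> i *s x i)"
        using finJ finS disj by (rule sum.union_disjoint)
      also have "\<dots> = (\<Sum>i\<in>J. \<alpha> i *s x i) + (\<Sum>i\<in>S. a' i *s x i)"
        using disj by (intro arg_cong2[of _ _ _ _ "(+)"] sum.cong) auto
      also have "\<dots> = w" using \<alpha>(2) by (simp add: algebra_simps)
      finally show "\<exists>\<alpha>. (\<forall>i\<in>J \<union> S. \<alpha> i \<in> A) \<and> w = (\<Sum>i\<in>J \<union> S. \<alpha> i *s x i)"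
        using \<alpha>(1) a'(1) by (intro exI[of _ ?\<beta>]) auto
    qed
  qed
qed

lemma representable:
  fixes x :: "'i \<Rightarrow> 'p::prime_card mod_ring ^ 'n"
  assumes "r_arithmetic r A" "r > 0" "finite I"
    and "\<And>W. vec.subspace W \<Longrightarrow> W \<noteq> UNIV \<Longrightarrow>
      (CARD('p) - 1) * (CARD('n) - vec.dim W) < r * card {i\<in>I. x i \<notin> W}"
  shows "\<exists>\<alpha>. (\<forall>i\<in>I. \<alpha> i \<in> A) \<and> w = (\<Sum>i\<in>I. \<alpha> i *s x i)"
  \<comment> \<open>The start is the empty family, whose span is zero.\<close>
  by (rule representable_aux[OF assms, of "{}"]) auto

section \<open>Counting basis vectors outside a subspace, and the conclusion\<close>

lemma card_basis_outside_subspace: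
  fixes W :: "('a::field ^ 'n) set"
  assumes "is_linear_basis S" "vec.subspace W"
  shows "finite S" "CARD('n) - vec.dim W \<le> card (S - W)"
proof -
  have ind: "vec.independent S" and span: "vec.span S = UNIV"
    using assms(1) by (auto simp: is_linear_basis_def)
  show fin: "finite S" using ind vec.finiteI_independent by blast
  have "card S = CARD('n)"
    using vec.dim_eq_card_independent[OF ind] span by (metis vec.dim_span vec_dim_card)
  moreover have "card (S \<inter> W) \<le> vec.dim W"
    using vec.independent_mono[OF ind] by (intro vec.independent_card_le_dim) auto
  moreover have "card S = card (S - W) + card (S \<inter> W)"
    using fin by (metis card_Int_Diff add.commute)
  ultimately show "CARD('n) - vec.dim W \<le> card (S - W)" by linarith
qed

theorem theorem3p1:
  fixes p r m :: nat
    and A :: "'p::prime_card mod_ring set"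
    and B :: "('p mod_ring ^ 'n) multiset"
  assumes "p = CARD('p)"
    and "r \<in> {1..p - 1}"
    and "r_arithmetic r A"
    and "real m \<ge> real p / real r"
    and "is_union_of_bases m B"
  shows "\<forall>w. is_combination_with_coeffs_in A B w"
proof
  fix w :: "'p mod_ring ^ 'n"
  obtain S :: "nat \<Rightarrow> ('p mod_ring ^ 'n) set" where
    S: "\<And>i. i < m \<Longrightarrow> is_linear_basis (S i)" and B: "B = (\<Sum>i<m. mset_set (S i))"
    using assms(5) unfolding is_union_of_bases_def by blast
  have r: "r > 0" using assms(2) by simp
  have "real p \<le> real (r * m)"
    using assms(4) r by (simp add: divide_le_eq mult.commute)
  then have prm: "p \<le> r * m" by linarith
  \<comment> \<open>Copies of \<open>v\<close> become pairs \<open>(v, j)\<close>, turning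
    multiplicities into distinct indices.\<close>
  let ?I = "SIGMA v:set_mset B. {..<count B v}"
  have "\<exists>\<alpha>. (\<forall>i\<in>?I. \<alpha> i \<in> A) \<and> w = (\<Sum>i\<in>?I. \<alpha> i *s fst i)"
  proof (rule representable[OF assms(3) r])
    fix W :: "('p mod_ring ^ 'n) set"
    assume W: "vec.subspace W" "W \<noteq> UNIV"
    let ?d = "CARD('n) - vec.dim W"
    \<comment> \<open>Properness of \<open>W\<close> makes the codimension positive, which gives the
      strict inequality between \<open>p - 1\<close> and \<open>p\<close> multiples of it.\<close>
    have "vec.dim W < CARD('n)"
      using W vec.dim_psubset[of W UNIV]
      by (metis top.not_eq_extremum vec.span_UNIV vec.span_eq_iff vec_dim_card)
    then have "(p - 1) * ?d < p * ?d"
      using assms(1) by simp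
    also have "\<dots> \<le> r * (m * ?d)"
      using mult_right_mono[OF prm, of ?d] by (simp add: mult.assoc)
    also have "m * ?d \<le> (\<Sum>i<m. card (S i - W))"
      using sum_mono[of "{..<m}" "\<lambda>_. ?d" "\<lambda>i. card (S i - W)"]
        card_basis_outside_subspace(2)[OF S W(1)] by simp
    also have "\<dots> = size (filter_mset (\<lambda>v. v \<notin> W) B)"
    proof -
      have "filter_mset (\<lambda>v. v \<notin> W) B = (\<Sum>i<m. mset_set (S i - W))"
        unfolding B filter_mset_sum
        by (intro sum.cong)
          (auto simp: card_basis_outside_subspace(1)[OF S W(1)] set_diff_eq)
      then show ?thesis by (simp add: size_multiset_sum)
    qed
    also have "\<dots> = card {i\<in>?I. fst i \<notin> W}"
    proof -
      have "{i\<in>?I. fst i \<notin> W} = (SIGMA v:{v\<in>set_mset B. v \<notin> W}. {..<count B v})"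
        by auto
      then show ?thesis by (simp add: size_multiset_overloaded_eq)
    qed
    finally show "(CARD('p) - 1) * ?d < r * card {i\<in>?I. fst i \<notin> W}"
      using assms(1) r by simp
  qed simp
  then obtain \<alpha> where \<alpha>: "\<forall>i\<in>?I. \<alpha> i \<in> A" "w = (\<Sum>i\<in>?I. \<alpha> i *s fst i)"
    by blast
  then show "is_combination_with_coeffs_in A B w"
    unfolding is_combination_with_coeffs_in_def
    by (intro exI[of _ "\<lambda>v j. \<alpha> (v, j)"]) (auto simp: sum.Sigma case_prod_unfold)
qed

end
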